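(* Let $G$ be a finite simple graph without isolated vertices on $\{1,\ldots,r\}$, where $r\ge 8$. Assume that $\tau_{\max}(G)\le r-4$, equivalently, that every maximal independent set of $G$ has size at least $4$. Let $m$ be any integer such that $$3\le m\le\min\left\{\frac{r-\tau_{\max}(G)+3}{2},\ \frac r2\right\}.$$ Let $O(m)$ be the graph on the $m$ vertices $\{y_1,\ldots,y_m\}$ with no edges, and let $G_m=G*O(m)$ be the join of $G$ and $O(m)$. Then: (1) $G_m$ is a connected graph, but has none of the properties bipartite, unmixed, and claw-free; (2) $\delta(J(G_m))=\tau_{\max}(G_m)=r$.
   Context: The join $G*H$ of two graphs has vertex set $V(G)\sqcup V(H)$ and edge set $E(G)\sqcup E(H)\sqcup\{\{x,y\}:x\in V(G),y\in V(H)\}$. For a graph $\Gamma$: $\tau_{\max}(\Gamma)$ is the maximal cardinality of a minimal (with respect to inclusion) vertex cover of $\Gamma$; $\Gamma$ is unmixed if all its minimal vertex covers have the same size; $\Gamma$ is claw-free if it does not contain $K_{1,3}$ as an induced subgraph. Maximal independent sets are maximal with respect to inclusion. The cover ideal of $\Gamma$ is $J(\Gamma)=\bigcap_{\{u,v\}\in E(\Gamma)}(x_u,x_v)$ in the polynomial ring $k[x_v : v\in V(\Gamma)]$ over a field $k$. Let $\mathcal{SP}(J(\Gamma))=\{\mathbf x\in\mathbb R^{V(\Gamma)} : x_v\ge0 \text{ for all } v,\ x_u+x_v\ge1 \text{ for all } \{u,v\}\in E(\Gamma)\}$, and $\delta(J(\Gamma))=\max\{\sum_v p_v : (p_v)_v\text{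 is a vertex (extreme point) of the polyhedron }\mathcal{SP}(J(\Gamma))\}$. *)

theory Defs
  imports "HOL-Analysis.Analysis"
begin

text \<open>
  A graph whose vertex set is the whole type \<open>'v\<close> is given by its set of edges; finiteness of
  the vertex set is the class constraint \<open>'v :: finite\<close>, the number of vertices is
  \<open>CARD('v)\<close>, and \<open>real ^ 'v\<close> is the space of real vectors indexed by the vertices.
\<close>

type_synonym 'v graph = "'v set set"

definition simple_graph :: "'v graph \<Rightarrow> bool" where
  "simple_graph E \<longleftrightarrow> (\<forall>e\<in>E. card e = 2)"

definition no_isolated_vertices :: "'v graph \<Rightarrow> bool" where
  "no_isolated_vertices E \<longleftrightarrow> (\<forall>v. \<exists>u. {u, v} \<in> E)"

definition edgeless_graph :: "'v graph" where
  "edgeless_graph = {}"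

definition graph_join :: "'a graph \<Rightarrow> 'b graph \<Rightarrow> ('a + 'b) graph" where
  "graph_join E F = (\<lambda>e. Inl ` e) ` E \<union> (\<lambda>e. Inr ` e) ` F \<union> {{Inl x, Inr y} | x y. True}"

definition connected_graph :: "'v graph \<Rightarrow> bool" where
  "connected_graph E \<longleftrightarrow> (\<forall>u v. (u, v) \<in> {(a, b). {a, b} \<in> E}\<^sup>*)"

definition bipartite_graph :: "'v graph \<Rightarrow> bool" where
  "bipartite_graph E \<longleftrightarrow>
     (\<exists>A B. A \<union> B = UNIV \<and> A \<inter> B = {} \<and> (\<forall>e\<in>E. \<exists>a\<in>A. \<exists>b\<in>B. e = {a, b}))"

definition vertex_cover :: "'v graph \<Rightarrow> 'v set \<Rightarrow> bool" where
  "vertex_cover E C \<longleftrightarrow> (\<forall>e\<in>E. e \<inter> C \<noteq> {})"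

definition minimal_vertex_cover :: "'v graph \<Rightarrow> 'v set \<Rightarrow> bool" where
  "minimal_vertex_cover E C \<longleftrightarrow> vertex_cover E C \<and> (\<forall>D. D \<subset> C \<longrightarrow> \<not> vertex_cover E D)"

definition tau_max :: "'v::finite graph \<Rightarrow> nat" where
  "tau_max E = Max (card ` {C. minimal_vertex_cover E C})"

definition unmixed_graph :: "'v::finite graph \<Rightarrow> bool" where
  "unmixed_graph E \<longleftrightarrow>
     (\<forall>C D. minimal_vertex_cover E C \<longrightarrow> minimal_vertex_cover E D \<longrightarrow> card C = card D)"

definition independent_vertices :: "'v graph \<Rightarrow> 'v set \<Rightarrow> bool" where
  "independent_vertices E S \<longleftrightarrow> (\<forall>u\<in>S. \<forall>v\<in>S. {u, v} \<notin> E)"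

definition maximal_independent_vertices :: "'v graph \<Rightarrow> 'v set \<Rightarrow> bool" where
  "maximal_independent_vertices E S \<longleftrightarrow>
     independent_vertices E S \<and> (\<forall>T. S \<subset> T \<longrightarrow> \<not> independent_vertices E T)"

definition has_induced_subgraph :: "'v graph \<Rightarrow> 'w graph \<Rightarrow> bool" where
  "has_induced_subgraph E F \<longleftrightarrow>
     (\<exists>f :: 'w \<Rightarrow> 'v. inj f \<and> (\<forall>a b. {f a, f b} \<in> E \<longleftrightarrow> {a, b} \<in> F))"

text \<open>The claw \<open>K\<^sub>1\<^sub>,\<^sub>3\<close> is the join of the edgeless graphs on one and on three vertices.\<close>

definition claw_graph :: "(1 + 3) graph" where
  "claw_graph = graph_join (edgeless_graph :: 1 graph) (edgeless_graph :: 3 graph)"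

definition claw_free_graph :: "'v graph \<Rightarrow> bool" where
  "claw_free_graph E \<longleftrightarrow> \<not> has_induced_subgraph E claw_graph"

text \<open>
  The symbolic polyhedron \<open>SP(J(E))\<close> of the cover ideal \<open>J(E)\<close>, given by its defining inequalities:
  each component \<open>(x\<^sub>u, x\<^sub>v)\<close> of the ideal contributes \<open>x\<^sub>u + x\<^sub>v \<ge> 1\<close>. It does not depend on the
  coefficient field.
\<close>

definition cover_ideal_SP :: "'v::finite graph \<Rightarrow> (real ^ 'v) set" where
  "cover_ideal_SP E =
     {x. (\<forall>v. 0 \<le> x $ v) \<and> (\<forall>u v. {u, v} \<in> E \<longrightarrow> 1 \<le> x $ u + x $ v)}"

definition cover_ideal_delta :: "'v::finite graph \<Rightarrow> real" where
  "cover_ideal_delta E = Max {\<Sum>v\<in>UNIV. p $ v | p. p extreme_point_of cover_ideal_SP E}"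

end

theory Submission
  imports Defs
begin

text \<open>
  Taking complements turns minimal vertex covers into maximal independent sets, and a maximal
  independent set of a join lies entirely in one factor. So the minimal vertex covers of \<open>G\<^sub>m\<close> are
  \<open>V(G)\<close>, of size \<open>r\<close>, and the sets \<open>C \<union> O(m)\<close> with \<open>C\<close> a minimal vertex cover of \<open>G\<close>. Writing
  \<open>d = r - \<tau>\<^sub>m\<^sub>a\<^sub>x(G) \<ge> 4\<close>, the latter have size at most \<open>m + \<tau>\<^sub>m\<^sub>a\<^sub>x(G)\<close>, and \<open>2m \<le> d + 3 < 2d\<close>
  makes this smaller than \<open>r\<close>. This gives \<open>\<tau>\<^sub>m\<^sub>a\<^sub>x(G\<^sub>m) = r\<close> and the failure of unmixedness. An edge of \<open>G\<close>
  together with a vertex of \<open>O(m)\<close> is a triangle, and a vertex of \<open>G\<close> with three vertices of \<open>O(m)\<close>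
  is a claw.

  For \<open>\<delta>\<close>, the characteristic vector of a minimal vertex cover is an extreme point, so
  \<open>\<delta> \<ge> r\<close>. For the converse, an extreme point \<open>p\<close> admits no nonzero direction that keeps all its
  tight constraints tight (lemma \<open>extreme_point_rigid\<close>). Testing this on well-chosen directions
  shows that \<open>p\<close> has entries in \<open>{0, 1/2, 1}\<close>, that every entry \<open>1\<close> has a neighbouring entry \<open>0\<close>,
  and that the set \<open>H\<close> of the vertices with entry \<open>1/2\<close>, unless empty, keeps at least two vertices
  outside any independent set. Let \<open>Z\<close> be the zero set of \<open>p\<close>, extended to a maximal independent
  set \<open>S\<close>. If \<open>H\<close> is empty, then \<open>p\<close> is the characteristic vector of the complement of \<open>S\<close>, a
  minimal vertex cover.
  Otherwise the three facts give
  \<open>2 \<Sum>p + \<bar>Z\<bar> + \<bar>S\<bar> + 2 \<le> 2\<bar>V\<bar>\<close> (lemma \<open>extreme_point_sum_bound\<close>). In \<open>G\<^sub>m\<close>, where \<open>\<bar>V\<bar> = r + m\<close>,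
  this gives \<open>\<Sum>p \<le> r\<close> as soon as \<open>2m \<le> \<bar>Z\<bar> + \<bar>S\<bar> + 2\<close>. If \<open>Z\<close> meets \<open>G\<close>, then \<open>\<bar>Z\<bar> \<ge> 1\<close> and
  \<open>\<bar>S\<bar> \<ge> d\<close>, which explains the bound \<open>2m \<le> d + 3\<close>. If \<open>Z\<close> is empty, then \<open>p\<close> is constantly \<open>1/2\<close>
  and \<open>m \<le> r\<close> suffices. If \<open>Z\<close> meets \<open>O(m)\<close>, then \<open>p\<close> is \<open>1\<close> on all of \<open>G\<close>, so \<open>H\<close> is contained in
  the independent set \<open>O(m)\<close> and must be empty.
\<close>

section \<open>Maximal independent sets and minimal vertex covers\<close>

lemma simple_graph_irrefl:
  assumes "simple_graph E"
  shows "{v, v} \<notin> E"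
  using assms unfolding simple_graph_def by force

lemma maximal_independent_iff:
  assumes "simple_graph E"
  shows "maximal_independent_vertices E S \<longleftrightarrow> (\<forall>v. v \<in> S \<longleftrightarrow> (\<forall>u\<in>S. {u, v} \<notin> E))"
    (is "?L \<longleftrightarrow> ?R")
proof
  assume L: ?L
  have ind: "\<And>u v. u \<in> S \<Longrightarrow> v \<in> S \<Longrightarrow> {u, v} \<notin> E"
    using L unfolding maximal_independent_vertices_def independent_vertices_def by blast
  have "v \<in> S" if v: "\<forall>u\<in>S. {u, v} \<notin> E" for v
  proof (rule ccontr)
    assume "v \<notin> S"
    moreover have "independent_vertices E (insert v S)"
      using v ind simple_graph_irrefl[OF assms]
      unfolding independent_vertices_def by (metis insert_commute insert_iff)
    ultimately show False
      using L unfolding maximal_independent_vertices_def by blast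
  qed
  with ind show ?R by blast
next
  assume R: ?R
  have "\<not> independent_vertices E T" if T: "S \<subset> T" for T
  proof -
    obtain v where "v \<in> T" "v \<notin> S" using T by blast
    moreover then obtain u where "u \<in> S" "{u, v} \<in> E" using R by blast
    ultimately show ?thesis using T unfolding independent_vertices_def by blast
  qed
  then show ?L
    using R unfolding maximal_independent_vertices_def independent_vertices_def by blast
qed

lemma maximal_independent_extends:
  fixes E :: "'v::finite graph"
  assumes "independent_vertices E Z"
  obtains S where "Z \<subseteq> S" "maximal_independent_vertices E S"
proof -
  have "\<exists>S\<in>{S. independent_vertices E S}. Z \<subseteq> S \<and>
      (\<forall>T\<in>{S. independent_vertices E S}. S \<subseteq> T \<longrightarrow> S = T)"
    using assms by (intro finite_has_maximal2) auto
  then obtain S where "independent_vertices E S" "Z \<subseteq> S"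
    "\<forall>T\<in>{S. independent_vertices E S}. S \<subseteq> T \<longrightarrow> S = T" by blast
  then show thesis
    by (intro that[of S]) (auto simp: maximal_independent_vertices_def)
qed

lemma vertex_cover_iff_independent:
  assumes "simple_graph E"
  shows "vertex_cover E C \<longleftrightarrow> independent_vertices E (- C)"
proof
  assume "vertex_cover E C"
  then show "independent_vertices E (- C)"
    unfolding vertex_cover_def independent_vertices_def by fastforce
next
  assume I: "independent_vertices E (- C)"
  show "vertex_cover E C"
    unfolding vertex_cover_def
  proof
    fix e assume e: "e \<in> E"
    then obtain u v where "e = {u, v}"
      using assms unfolding simple_graph_def by (meson card_2_iff)
    then show "e \<inter> C \<noteq> {}"
      using I e unfolding independent_vertices_def by blast
  qed
qed

lemma minimal_vertex_cover_iff_maximal_independent: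
  assumes "simple_graph E"
  shows "minimal_vertex_cover E C \<longleftrightarrow> maximal_independent_vertices E (- C)"
proof -
  have "(\<forall>D. D \<subset> C \<longrightarrow> \<not> independent_vertices E (- D)) \<longleftrightarrow>
      (\<forall>T. - C \<subset> T \<longrightarrow> \<not> independent_vertices E T)"
    by (metis compl_less_compl_iff double_compl)
  then show ?thesis
    unfolding minimal_vertex_cover_def maximal_independent_vertices_def
    using vertex_cover_iff_independent[OF assms] by auto
qed

lemma card_Compl_add:
  fixes S :: "'v::finite set"
  shows "card (- S) + card S = CARD('v)"
  by (metis Compl_disjoint2 Compl_partition2 card_Un_disjoint finite)

lemma card_le_tau_max:
  fixes E :: "'v::finite graph"
  assumes "minimal_vertex_cover E C"
  shows "card C \<le> tau_max E"
  unfolding tau_max_def using assms by (intro Max_ge) auto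

lemma tau_max_attained:
  fixes E :: "'v::finite graph"
  assumes "simple_graph E"
  obtains C where "minimal_vertex_cover E C" "card C = tau_max E"
proof -
  have "independent_vertices E {}"
    unfolding independent_vertices_def by simp
  then obtain S where "maximal_independent_vertices E S"
    by (rule maximal_independent_extends)
  then have "minimal_vertex_cover E (- S)"
    using minimal_vertex_cover_iff_maximal_independent[OF assms] by simp
  then have "tau_max E \<in> card ` {C. minimal_vertex_cover E C}"
    unfolding tau_max_def by (intro Max_in) auto
  then show thesis using that by auto
qed

lemma card_maximal_independent_ge:
  fixes E :: "'v::finite graph"
  assumes "simple_graph E" "maximal_independent_vertices E S"
  shows "CARD('v) \<le> card S + tau_max E"
proof -
  have "minimal_vertex_cover E (- S)"
    using assms minimal_vertex_cover_iff_maximal_independent by fastforce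
  from card_le_tau_max[OF this] show ?thesis
    using card_Compl_add[of S] by simp
qed

lemma tau_max_le_iff:
  fixes E :: "'v::finite graph"
  assumes "simple_graph E" "k \<le> CARD('v)"
  shows "tau_max E \<le> CARD('v) - k \<longleftrightarrow> (\<forall>S. maximal_independent_vertices E S \<longrightarrow> k \<le> card S)"
proof
  assume "tau_max E \<le> CARD('v) - k"
  then show "\<forall>S. maximal_independent_vertices E S \<longrightarrow> k \<le> card S"
    using card_maximal_independent_ge[OF assms(1)] assms(2) by fastforce
next
  assume R: "\<forall>S. maximal_independent_vertices E S \<longrightarrow> k \<le> card S"
  obtain C where C: "minimal_vertex_cover E C" "card C = tau_max E"
    using tau_max_attained[OF assms(1)] .
  then have "k \<le> card (- C)"
    using R minimal_vertex_cover_iff_maximal_independent[OF assms(1)] by blast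
  then show "tau_max E \<le> CARD('v) - k"
    using C(2) card_Compl_add[of C] by simp
qed

section \<open>Joins\<close>

lemma graph_join_edge_simps [simp]:
  fixes E :: "'a graph" and F :: "'b graph"
  shows
  "{Inl a, Inl b} \<in> graph_join E F \<longleftrightarrow> {a, b} \<in> E"
  "{Inr c, Inr d} \<in> graph_join E F \<longleftrightarrow> {c, d} \<in> F"
  "{Inl a, Inr d} \<in> graph_join E F"
  "{Inr d, Inl a} \<in> graph_join E F"
proof -
  have l: "{Inl a, Inl b} = Inl ` e \<longleftrightarrow> {a, b} = e" for e :: "'a set"
    using inj_image_eq_iff[OF inj_Inl, of "{a, b}" e] by simp
  have r: "{Inr c, Inr d} = Inr ` f \<longleftrightarrow> {c, d} = f" for f :: "'b set"
    using inj_image_eq_iff[OF inj_Inr, of "{c, d}" f] by simp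
  have n: "{Inl a, Inl b} \<noteq> Inr ` f" "{Inr c, Inr d} \<noteq> Inl ` e"
    for e :: "'a set" and f :: "'b set"
    by (metis Inl_Inr_False imageE insertI1, metis Inr_Inl_False imageE insertI1)
  show "{Inl a, Inl b} \<in> graph_join E F \<longleftrightarrow> {a, b} \<in> E"
    "{Inr c, Inr d} \<in> graph_join E F \<longleftrightarrow> {c, d} \<in> F"
    unfolding graph_join_def image_iff Un_iff by (simp_all add: l r n doubleton_eq_iff)
  show "{Inl a, Inr d} \<in> graph_join E F" "{Inr d, Inl a} \<in> graph_join E F"
    unfolding graph_join_def by (auto simp: doubleton_eq_iff)
qed

lemma simple_graph_edgeless [simp]: "simple_graph edgeless_graph"
  unfolding simple_graph_def edgeless_graph_def by simp

lemma simple_graph_join: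
  assumes "simple_graph E" "simple_graph F"
  shows "simple_graph (graph_join E F)"
  using assms unfolding simple_graph_def graph_join_def
  by (auto simp: card_image)

lemma maximal_independent_edgeless:
  "maximal_independent_vertices edgeless_graph S \<longleftrightarrow> S = UNIV"
  unfolding maximal_independent_iff[OF simple_graph_edgeless] by (auto simp: edgeless_graph_def)

lemma maximal_independent_join_iff:
  assumes E: "simple_graph E" and F: "simple_graph F"
  shows "maximal_independent_vertices (graph_join E F) S \<longleftrightarrow>
    (\<exists>T. maximal_independent_vertices E T \<and> S = Inl ` T) \<or>
    (\<exists>T. maximal_independent_vertices F T \<and> S = Inr ` T)" (is "?L \<longleftrightarrow> ?R")
proof
  assume ?L
  then have S: "v \<in> S \<longleftrightarrow> (\<forall>u\<in>S. {u, v} \<notin> graph_join E F)" for v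
    using maximal_independent_iff[OF simple_graph_join[OF E F]] by blast
  then have "S \<noteq> {}" by blast
  then consider (l) x where "Inl x \<in> S" | (r) y where "Inr y \<in> S"
    by (metis ex_in_conv sum.exhaust)
  then show ?R
  proof cases
    case l
    then have no: "Inr y \<notin> S" for y
      using S[of "Inr y"] by auto
    define T where "T = Inl -` S"
    have eq: "S = Inl ` T"
    proof (intro set_eqI)
      fix v show "v \<in> S \<longleftrightarrow> v \<in> Inl ` T"
        using no unfolding T_def by (cases v) auto
    qed
    have "a \<in> T \<longleftrightarrow> (\<forall>b\<in>T. {b, a} \<notin> E)" for a
      using S[of "Inl a"] unfolding eq by (simp add: inj_image_mem_iff)
    then have "maximal_independent_vertices E T"
      unfolding maximal_independent_iff[OF E] by blast
    with eq show ?thesis by blast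
  next
    case r
    then have no: "Inl x \<notin> S" for x
      using S[of "Inl x"] by auto
    define T where "T = Inr -` S"
    have eq: "S = Inr ` T"
    proof (intro set_eqI)
      fix v show "v \<in> S \<longleftrightarrow> v \<in> Inr ` T"
        using no unfolding T_def by (cases v) auto
    qed
    have "a \<in> T \<longleftrightarrow> (\<forall>b\<in>T. {b, a} \<notin> F)" for a
      using S[of "Inr a"] unfolding eq by (simp add: inj_image_mem_iff)
    then have "maximal_independent_vertices F T"
      unfolding maximal_independent_iff[OF F] by blast
    with eq show ?thesis by blast
  qed
next
  assume ?R
  then show ?L
  proof (elim disjE exE conjE)
    fix T assume T: "maximal_independent_vertices E T" and S: "S = Inl ` T"
    have T': "\<And>v. v \<in> T \<longleftrightarrow> (\<forall>u\<in>T. {u, v} \<notin> E)"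
      using T unfolding maximal_independent_iff[OF E] by blast
    have "T \<noteq> {}" using T' by blast
    show ?L
      unfolding maximal_independent_iff[OF simple_graph_join[OF E F]] S
    proof
      fix v show "v \<in> Inl ` T \<longleftrightarrow> (\<forall>u\<in>Inl ` T. {u, v} \<notin> graph_join E F)"
        using \<open>T \<noteq> {}\<close> T'[of "projl v"] by (cases v) auto
    qed
  next
    fix T assume T: "maximal_independent_vertices F T" and S: "S = Inr ` T"
    have T': "\<And>v. v \<in> T \<longleftrightarrow> (\<forall>u\<in>T. {u, v} \<notin> F)"
      using T unfolding maximal_independent_iff[OF F] by blast
    have "T \<noteq> {}" using T' by blast
    show ?L
      unfolding maximal_independent_iff[OF simple_graph_join[OF E F]] S
    proof
      fix v show "v \<in> Inr ` T \<longleftrightarrow> (\<forall>u\<in>Inr ` T. {u, v} \<notin> graph_join E F)"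
        using \<open>T \<noteq> {}\<close> T'[of "projr v"] by (cases v) auto
    qed
  qed
qed

lemma connected_graph_join: "connected_graph (graph_join E F)"
proof -
  let ?R = "{(a, b). {a, b} \<in> graph_join E F}"
  have lr: "(Inl x, Inr y) \<in> ?R\<^sup>*" and rl: "(Inr y, Inl x) \<in> ?R\<^sup>*" for x y
    by auto
  have "(u, v) \<in> ?R\<^sup>*" for u v
  proof (cases u; cases v)
    fix a b assume "u = Inl a" "v = Inl b"
    then show ?thesis using rtrancl_trans[OF lr rl] by blast
  next
    fix a b assume "u = Inr a" "v = Inr b"
    then show ?thesis using rtrancl_trans[OF rl lr] by blast
  qed (use lr rl in auto)
  then show ?thesis unfolding connected_graph_def by blast
qed

lemma triangle_not_bipartite:
  assumes "{a, b} \<in> E" "{b, c} \<in> E" "{a, c} \<in> E"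
  shows "\<not> bipartite_graph E"
proof
  assume "bipartite_graph E"
  then obtain A B where AB: "A \<union> B = UNIV" "A \<inter> B = {}"
    "\<forall>e\<in>E. \<exists>a\<in>A. \<exists>b\<in>B. e = {a, b}"
    unfolding bipartite_graph_def by blast
  have "u \<in> A \<longleftrightarrow> v \<notin> A" if e: "{u, v} \<in> E" for u v
  proof -
    obtain a b where "a \<in> A" "b \<in> B" "{u, v} = {a, b}" using bspec[OF AB(3) e] by blast
    then show ?thesis using AB(2) by (auto simp: doubleton_eq_iff)
  qed
  from this[OF assms(1)] this[OF assms(2)] this[OF assms(3)] show False by simp
qed

lemma claw_in_join_edgeless:
  fixes E :: "'a graph"
  assumes "simple_graph E" "3 \<le> CARD('m::finite)"
  shows "\<not> claw_free_graph (graph_join E (edgeless_graph :: 'm graph))"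
proof -
  have "card (UNIV :: 3 set) \<le> card (UNIV :: 'm set)"
    using assms(2) by simp
  then obtain g :: "3 \<Rightarrow> 'm" where g: "inj g"
    using card_le_inj[of "UNIV :: 3 set" "UNIV :: 'm set"] by auto
  define f :: "1 + 3 \<Rightarrow> 'a + 'm" where
    "f = case_sum (\<lambda>_. Inl undefined) (\<lambda>i. Inr (g i))"
  have "inj f"
    unfolding f_def using g by (auto simp: inj_def split: sum.splits)
  moreover have "{f a, f b} \<in> graph_join E edgeless_graph \<longleftrightarrow> {a, b} \<in> claw_graph" for a b
    using simple_graph_irrefl[OF simple_graph_join[OF assms(1) simple_graph_edgeless]]
    unfolding f_def claw_graph_def
    by (cases a; cases b) (simp_all, simp_all add: edgeless_graph_def)
  ultimately show ?thesis
    unfolding claw_free_graph_def has_induced_subgraph_def by blast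
qed

section \<open>Extreme points of the symbolic polyhedron\<close>

text \<open>
  A direction that preserves every tight constraint can be followed a small distance both ways
  without violating a slack one, which makes the point a proper midpoint.
\<close>

lemma extreme_point_rigid:
  fixes p d :: "real ^ 'v::finite"
  assumes p: "p extreme_point_of cover_ideal_SP E"
    and zero: "\<And>v. p $ v = 0 \<Longrightarrow> d $ v = 0"
    and tight: "\<And>u v. {u, v} \<in> E \<Longrightarrow> p $ u + p $ v = 1 \<Longrightarrow> d $ u + d $ v = 0"
  shows "d = 0"
proof -
  have P0: "\<And>v. 0 \<le> p $ v" and P1: "\<And>u v. {u, v} \<in> E \<Longrightarrow> 1 \<le> p $ u + p $ v"
    using p unfolding extreme_point_of_def cover_ideal_SP_def by auto
  have small: "\<forall>\<^sub>F e in at_right 0. e * \<bar>c\<bar> < a" if "0 < a" for a c :: real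
  proof -
    have "((\<lambda>e. e * \<bar>c\<bar>) \<longlongrightarrow> 0) (at_right 0)"
      by (auto intro!: tendsto_eq_intros)
    then show ?thesis using that by (rule order_tendstoD)
  qed
  have "\<forall>\<^sub>F e in at_right 0. p $ v \<noteq> 0 \<longrightarrow> e * \<bar>d $ v\<bar> < p $ v" for v
    using P0[of v] small[of "p $ v" "d $ v"] by (cases "p $ v = 0") auto
  then have ev0: "\<forall>\<^sub>F e in at_right 0. \<forall>v. p $ v \<noteq> 0 \<longrightarrow> e * \<bar>d $ v\<bar> < p $ v"
    by (rule eventually_all_finite)
  have "\<forall>\<^sub>F e in at_right 0. {u, v} \<in> E \<and> p $ u + p $ v \<noteq> 1 \<longrightarrow>
      e * \<bar>d $ u + d $ v\<bar> < p $ u + p $ v - 1" for u v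
    using P1[of u v] small[of "p $ u + p $ v - 1" "d $ u + d $ v"]
    by (cases "{u, v} \<in> E \<and> p $ u + p $ v \<noteq> 1") auto
  then have ev1: "\<forall>\<^sub>F e in at_right 0. \<forall>u v. {u, v} \<in> E \<and> p $ u + p $ v \<noteq> 1 \<longrightarrow>
      e * \<bar>d $ u + d $ v\<bar> < p $ u + p $ v - 1"
    by (intro eventually_all_finite)
  have "\<forall>\<^sub>F e in at_right 0. (0::real) < e"
    by (rule eventually_at_right_less)
  then obtain e where "0 < e"
    and e0: "\<And>v. p $ v \<noteq> 0 \<Longrightarrow> e * \<bar>d $ v\<bar> < p $ v"
    and e1: "\<And>u v. {u, v} \<in> E \<Longrightarrow> p $ u + p $ v \<noteq> 1 \<Longrightarrow>
      e * \<bar>d $ u + d $ v\<bar> < p $ u + p $ v - 1"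
    using eventually_happens'[OF trivial_limit_at_right_real
        eventually_conj[OF ev0 eventually_conj[OF ev1]]] by blast
  have step: "p + s *\<^sub>R d \<in> cover_ideal_SP E" if s: "\<bar>s\<bar> = e" for s
  proof -
    have abs: "\<bar>s * c\<bar> = e * \<bar>c\<bar>" for c using s by (simp add: abs_mult)
    have "0 \<le> p $ v + s * d $ v" for v
      using e0[of v] zero[of v] abs[of "d $ v"] by (cases "p $ v = 0") auto
    moreover have "1 \<le> p $ u + s * d $ u + (p $ v + s * d $ v)" if "{u, v} \<in> E" for u v
    proof -
      have "1 \<le> p $ u + p $ v + s * (d $ u + d $ v)"
        using e1[OF that] tight[OF that] abs[of "d $ u + d $ v"]
        by (cases "p $ u + p $ v = 1") auto
      then show ?thesis by (simp add: algebra_simps)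
    qed
    ultimately show ?thesis unfolding cover_ideal_SP_def by simp
  qed
  have "midpoint (p + e *\<^sub>R d) (p + (- e) *\<^sub>R d) = p"
    by (simp add: midpoint_def scaleR_2[symmetric])
  moreover have "p + e *\<^sub>R d \<in> cover_ideal_SP E" "p + (- e) *\<^sub>R d \<in> cover_ideal_SP E"
    using step[of e] step[of "- e"] \<open>0 < e\<close> by simp_all
  ultimately have "p + e *\<^sub>R d = p + (- e) *\<^sub>R d"
    using p midpoint_in_open_segment unfolding extreme_point_of_def by metis
  then have "e * d $ v = 0" for v
    using arg_cong[of _ _ "\<lambda>x. x $ v"] by fastforce
  then show ?thesis using \<open>0 < e\<close> by (simp add: vec_eq_iff)
qed

text \<open>Otherwise the entry at \<open>v\<close> alone could be varied.\<close>

lemma extreme_point_tight_neighbour: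
  fixes p :: "real ^ 'v::finite"
  assumes "simple_graph E" "p extreme_point_of cover_ideal_SP E" "p $ v \<noteq> 0"
  obtains u where "{u, v} \<in> E" "p $ u + p $ v = 1"
proof (rule ccontr)
  assume neg: "\<not> thesis"
  have "(axis v 1 :: real ^ 'v) = 0"
  proof (rule extreme_point_rigid[OF assms(2)])
    fix w assume "p $ w = 0"
    then show "axis v (1::real) $ w = 0" using assms(3) by (auto simp: axis_def)
  next
    fix u w assume *: "{u, w} \<in> E" "p $ u + p $ w = 1"
    then have "u \<noteq> v" "w \<noteq> v"
      using neg that by (metis insert_commute add.commute)+
    then show "axis v (1::real) $ u + axis v (1::real) $ w = 0" by (simp add: axis_def)
  qed
  then show False by (simp add: axis_eq_0_iff)
qed

text \<open>
  Pushing all entries other than \<open>0\<close>, \<open>1/2\<close> and \<open>1\<close> away from \<open>1/2\<close> at the same rate preserves every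
  tight edge: if one end has its entry in \<open>(0, 1/2)\<close>, the other has it in \<open>(1/2, 1)\<close>, and entries
  above \<open>1\<close> lie on no tight edge.
\<close>

lemma extreme_point_half_integral:
  fixes p :: "real ^ 'v::finite"
  assumes E: "simple_graph E" and p: "p extreme_point_of cover_ideal_SP E"
  shows "p $ v \<in> {0, 1/2, 1}"
proof -
  have P0: "\<And>v. 0 \<le> p $ v"
    using p unfolding extreme_point_of_def cover_ideal_SP_def by auto
  define d :: "real ^ 'v" where
    "d = (\<chi> v. if p $ v = 0 \<or> p $ v = 1 then 0 else sgn (p $ v - 1/2))"
  have "d = 0"
  proof (rule extreme_point_rigid[OF p])
    fix u v assume "{u, v} \<in> E" "p $ u + p $ v = 1"
    then have "p $ v = 1 - p $ u" by simp
    then show "d $ u + d $ v = 0" by (auto simp: d_def sgn_if)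
  qed (simp add: d_def)
  then have "d $ v = 0" by simp
  then show ?thesis
    by (auto simp: d_def sgn_if split: if_splits)
qed

lemma extreme_point_one_has_zero_neighbour:
  fixes p :: "real ^ 'v::finite"
  assumes "simple_graph E" "p extreme_point_of cover_ideal_SP E" "p $ v = 1"
  obtains u where "{u, v} \<in> E" "p $ u = 0"
proof -
  have "p $ v \<noteq> 0" using assms(3) by simp
  then obtain u where "{u, v} \<in> E" "p $ u + p $ v = 1"
    by (rule extreme_point_tight_neighbour[OF assms(1,2)])
  then show thesis using that assms(3) by simp
qed

text \<open>
  If an independent set misses at most one of the vertices with entry \<open>1/2\<close>, then the subgraph
  induced on these vertices is a star with isolated vertices, hence bipartite, and moving its two
  sides in opposite directions preserves every tight constraint.
\<close>

lemma extreme_point_halves_outside_independent: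
  fixes p :: "real ^ 'v::finite"
  assumes E: "simple_graph E" and p: "p extreme_point_of cover_ideal_SP E"
    and S: "independent_vertices E S" and ne: "{v. p $ v = 1/2} \<noteq> {}"
  shows "2 \<le> card ({v. p $ v = 1/2} - S)"
proof (rule ccontr)
  define H where "H = {v. p $ v = 1/2}"
  assume "\<not> ?thesis"
  then have "card (H - S) \<le> 1" unfolding H_def by simp
  then have one: "u = v" if "u \<in> H - S" "v \<in> H - S" for u v
    using that by (metis card_le_Suc0_iff_eq finite One_nat_def)
  define d :: "real ^ 'v" where
    "d = (\<chi> v. if v \<in> H then (if v \<in> S then 1 else -1) else 0)"
  have "d = 0"
  proof (rule extreme_point_rigid[OF p])
    fix v assume "p $ v = 0"
    then show "d $ v = 0" by (simp add: d_def H_def)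
  next
    fix u v assume e: "{u, v} \<in> E" and t: "p $ u + p $ v = 1"
    have "u \<noteq> v" using e simple_graph_irrefl[OF E] by blast
    moreover have "\<not> (u \<in> S \<and> v \<in> S)" using e S unfolding independent_vertices_def by blast
    moreover have "u \<in> H \<longleftrightarrow> v \<in> H" using t unfolding H_def by auto
    ultimately show "d $ u + d $ v = 0"
      using one unfolding d_def by auto
  qed
  moreover obtain v where "v \<in> H" using ne unfolding H_def by blast
  then have "d $ v \<noteq> 0" by (simp add: d_def)
  ultimately show False by simp
qed

lemma independent_zeros:
  fixes p :: "real ^ 'v::finite"
  assumes "p \<in> cover_ideal_SP E"
  shows "independent_vertices E {v. p $ v = 0}"
  using assms unfolding independent_vertices_def cover_ideal_SP_def by fastforce

lemma extreme_point_sum: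
  fixes p :: "real ^ 'v::finite"
  assumes "simple_graph E" "p extreme_point_of cover_ideal_SP E"
  shows "2 * (\<Sum>v\<in>UNIV. p $ v) + 2 * card {v. p $ v = 0} + card {v. p $ v = 1/2} = 2 * CARD('v)"
proof -
  have "2 * p $ v + 2 * of_bool (p $ v = 0) + of_bool (p $ v = 1/2) = 2" for v
    using extreme_point_half_integral[OF assms, of v] by auto
  then have "(\<Sum>v\<in>UNIV. 2 * p $ v + 2 * of_bool (p $ v = 0) + of_bool (p $ v = 1/2)) =
      2 * real CARD('v)"
    by simp
  then show ?thesis
    by (simp add: sum.distrib sum_distrib_left[symmetric] of_bool_def sum.If_cases)
qed

text \<open>
  Vertices with entry \<open>1\<close> have a neighbour with entry \<open>0\<close>, so \<open>S\<close> contains, besides the zeros, only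
  vertices with entry \<open>1/2\<close>; hence there are at least \<open>\<bar>S\<bar> - \<bar>Z\<bar>\<close> of these, and two more unless
  there are none.
\<close>

lemma extreme_point_sum_bound:
  fixes p :: "real ^ 'v::finite"
  assumes E: "simple_graph E" and p: "p extreme_point_of cover_ideal_SP E"
    and S: "maximal_independent_vertices E S" and Z: "{v. p $ v = 0} \<subseteq> S"
  shows "if {v. p $ v = 1/2} = {} then (\<Sum>v\<in>UNIV. p $ v) + card S = CARD('v)
    else 2 * (\<Sum>v\<in>UNIV. p $ v) + card {v. p $ v = 0} + card S + 2 \<le> 2 * CARD('v)"
proof -
  define H where "H = {v. p $ v = 1/2}"
  define Z where "Z = {v. p $ v = 0}"
  have ind: "independent_vertices E S"
    using S unfolding maximal_independent_vertices_def by blast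
  have "p $ v \<noteq> 1" if "v \<in> S" for v
  proof
    assume "p $ v = 1"
    then obtain u where "{u, v} \<in> E" "p $ u = 0"
      by (rule extreme_point_one_has_zero_neighbour[OF E p])
    then show False using ind that assms(4) unfolding independent_vertices_def by blast
  qed
  then have "S \<subseteq> Z \<union> H"
    using extreme_point_half_integral[OF E p] unfolding Z_def H_def by blast
  then have Seq: "S = Z \<union> (H \<inter> S)" using assms(4) unfolding Z_def by blast
  have "Z \<inter> (H \<inter> S) = {}" unfolding Z_def H_def by auto
  then have cS: "card S = card Z + card (H \<inter> S)"
    using Seq by (metis card_Un_disjoint finite)
  have cH: "card H = card (H \<inter> S) + card (H - S)"
    by (rule card_Int_Diff) simp
  have sum: "2 * (\<Sum>v\<in>UNIV. p $ v) + 2 * card Z + card H = 2 * CARD('v)"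
    using extreme_point_sum[OF E p] unfolding Z_def H_def .
  show ?thesis
  proof (cases "H = {}")
    case True
    then show ?thesis using sum cS unfolding H_def by simp
  next
    case False
    then have "2 \<le> card (H - S)"
      using extreme_point_halves_outside_independent[OF E p ind] unfolding H_def by blast
    then have "2 * (\<Sum>v\<in>UNIV. p $ v) + card Z + card S + 2 \<le> 2 * CARD('v)"
      using sum cS cH by linarith
    then show ?thesis using False unfolding H_def Z_def by presburger
  qed
qed

lemma finite_extreme_points_cover_ideal_SP:
  fixes E :: "'v::finite graph"
  assumes "simple_graph E"
  shows "finite {p. p extreme_point_of cover_ideal_SP E}"
proof (rule finite_subset)
  show "{p. p extreme_point_of cover_ideal_SP E} \<subseteq>
      vec_lambda ` (UNIV \<rightarrow>\<^sub>E {0, 1/2, 1 :: real})"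
  proof
    fix p assume "p \<in> {p. p extreme_point_of cover_ideal_SP E}"
    then have "vec_nth p \<in> UNIV \<rightarrow>\<^sub>E {0, 1/2, 1}"
      using extreme_point_half_integral[OF assms, of p] by (simp add: PiE_UNIV_domain)
    then show "p \<in> vec_lambda ` (UNIV \<rightarrow>\<^sub>E {0, 1/2, 1})"
      by (metis image_eqI vec_nth_inverse)
  qed
qed (intro finite_imageI finite_PiE; simp)

text \<open>
  On a segment through this point all entries outside \<open>C\<close> vanish, being nonnegative. Each vertex
  of \<open>C\<close> has a neighbour outside \<open>C\<close>, which forces its entry to be at least \<open>1\<close>, hence constantly
  \<open>1\<close>.
\<close>

lemma minimal_vertex_cover_extreme_point:
  fixes E :: "'v::finite graph"
  assumes E: "simple_graph E" and C: "minimal_vertex_cover E C"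
  shows "(\<chi> v. of_bool (v \<in> C)) extreme_point_of cover_ideal_SP E"
proof -
  let ?p = "(\<chi> v. of_bool (v \<in> C)) :: real ^ 'v"
  have C': "\<And>v. v \<notin> C \<longleftrightarrow> (\<forall>u\<in>-C. {u, v} \<notin> E)"
    using C maximal_independent_iff[OF E] minimal_vertex_cover_iff_maximal_independent[OF E]
    by (metis ComplD ComplI)
  have "1 \<le> ?p $ u + ?p $ v" if "{u, v} \<in> E" for u v
    using that C'[of v] by auto
  then have mem: "?p \<in> cover_ideal_SP E"
    unfolding cover_ideal_SP_def by simp
  have False if ab: "a \<in> cover_ideal_SP E" "b \<in> cover_ideal_SP E" and seg: "?p \<in> open_segment a b"
    for a b
  proof -
    obtain t where t: "0 < t" "t < 1" and eq: "?p = (1 - t) *\<^sub>R a + t *\<^sub>R b" and "a \<noteq> b"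
      using seg unfolding in_segment by blast
    have comp: "of_bool (v \<in> C) = (1 - t) * a $ v + t * b $ v" for v
      using arg_cong[OF eq, of "\<lambda>x. x $ v"] by simp
    have nn: "\<And>v. 0 \<le> a $ v" "\<And>v. 0 \<le> b $ v"
      and edge: "\<And>u v. {u, v} \<in> E \<Longrightarrow> 1 \<le> a $ u + a $ v"
        "\<And>u v. {u, v} \<in> E \<Longrightarrow> 1 \<le> b $ u + b $ v"
      using ab unfolding cover_ideal_SP_def by auto
    have squeeze: "x = c \<and> y = c" if "c \<le> x" "c \<le> y" "c = (1 - t) * x + t * y" for c x y :: real
    proof -
      have "(1 - t) * (x - c) + t * (y - c) = 0" using that(3) by (simp add: algebra_simps)
      moreover have "0 \<le> (1 - t) * (x - c)" "0 \<le> t * (y - c)" using t that by simp_all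
      ultimately have "(1 - t) * (x - c) = 0" "t * (y - c) = 0" by linarith+
      then show ?thesis using t by simp
    qed
    have out: "a $ v = 0 \<and> b $ v = 0" if "v \<notin> C" for v
      using squeeze[of 0 "a $ v" "b $ v"] nn comp[of v] that by simp
    have "a $ v = b $ v" for v
    proof (cases "v \<in> C")
      case True
      then obtain u where u: "u \<notin> C" "{u, v} \<in> E" using C'[of v] by blast
      then have "1 \<le> a $ v" "1 \<le> b $ v" using edge[of u v] out[of u] by auto
      then show ?thesis using squeeze[of 1 "a $ v" "b $ v"] comp[of v] True by simp
    next
      case False
      then show ?thesis using out by simp
    qed
    then show False using \<open>a \<noteq> b\<close> by (simp add: vec_eq_iff)
  qed
  with mem show ?thesis unfolding extreme_point_of_def by blast
qed

lemma cover_ideal_delta_eqI: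
  fixes E :: "'v::finite graph"
  assumes E: "simple_graph E"
    and le: "\<And>p. p extreme_point_of cover_ideal_SP E \<Longrightarrow> (\<Sum>v\<in>UNIV. p $ v) \<le> tau_max E"
  shows "cover_ideal_delta E = tau_max E"
proof -
  obtain C where C: "minimal_vertex_cover E C" "card C = tau_max E"
    using tau_max_attained[OF E] .
  let ?p = "(\<chi> v. of_bool (v \<in> C)) :: real ^ 'v"
  let ?sums = "(\<lambda>p. \<Sum>v\<in>UNIV. p $ v) ` {p. p extreme_point_of cover_ideal_SP E}"
  have "real (tau_max E) = (\<Sum>v\<in>UNIV. ?p $ v)"
    using C(2) by (simp add: of_bool_def sum.If_cases)
  moreover have "?p extreme_point_of cover_ideal_SP E"
    by (rule minimal_vertex_cover_extreme_point[OF E C(1)])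
  ultimately have "real (tau_max E) \<in> ?sums" by (rule image_eqI[OF _ CollectI])
  moreover have "finite ?sums"
    by (intro finite_imageI finite_extreme_points_cover_ideal_SP E)
  moreover have "x \<le> tau_max E" if "x \<in> ?sums" for x
    using that le by (elim imageE) simp
  ultimately have "Max ?sums = tau_max E"
    by (intro Max_eqI)
  then show ?thesis
    unfolding cover_ideal_delta_def setcompr_eq_image .
qed

section \<open>The join with an edgeless graph\<close>

lemma maximal_independent_join_edgeless_iff:
  assumes "simple_graph G"
  shows "maximal_independent_vertices (graph_join G edgeless_graph) S \<longleftrightarrow>
    (\<exists>T. maximal_independent_vertices G T \<and> S = Inl ` T) \<or> S = range Inr"
  by (simp add: maximal_independent_join_iff[OF assms simple_graph_edgeless]
      maximal_independent_edgeless)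

lemma card_maximal_independent_join_edgeless:
  fixes G :: "'n::finite graph"
  assumes G: "simple_graph G"
    and S: "maximal_independent_vertices (graph_join G edgeless_graph) S"
  shows "CARD('n) \<le> card S + tau_max G \<or> S = range Inr"
proof (cases "S = range Inr")
  case False
  then obtain T where T: "maximal_independent_vertices G T" "S = Inl ` T"
    using iffD1[OF maximal_independent_join_edgeless_iff[OF G] S] by blast
  have "card S = card T" unfolding T(2) by (simp add: card_image)
  then show ?thesis using card_maximal_independent_ge[OF G T(1)] by linarith
qed simp

lemma minimal_vertex_cover_join_left:
  fixes G :: "'a graph"
  assumes "simple_graph G"
  shows "minimal_vertex_cover (graph_join G (edgeless_graph :: 'b graph)) (range Inl)"
proof -
  have "- range Inl = (range Inr :: ('a + 'b) set)"
    using UNIV_sum by blast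
  then have "maximal_independent_vertices (graph_join G (edgeless_graph :: 'b graph)) (- range Inl)"
    by (intro iffD2[OF maximal_independent_join_edgeless_iff[OF assms]] disjI2)
  then show ?thesis
    by (rule iffD2[OF minimal_vertex_cover_iff_maximal_independent[OF
        simple_graph_join[OF assms simple_graph_edgeless]]])
qed

lemma tau_max_join_edgeless:
  fixes G :: "'n::finite graph"
  assumes G: "simple_graph G" and le: "CARD('m::finite) + tau_max G \<le> CARD('n)"
  shows "tau_max (graph_join G (edgeless_graph :: 'm graph)) = CARD('n)"
proof (rule antisym)
  let ?J = "graph_join G (edgeless_graph :: 'm graph)"
  have J: "simple_graph ?J" using G by (simp add: simple_graph_join)
  show "CARD('n) \<le> tau_max ?J"
    using card_le_tau_max[OF minimal_vertex_cover_join_left[OF G]]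
    by (simp add: card_image)
  obtain C where C: "minimal_vertex_cover ?J C" "card C = tau_max ?J"
    using tau_max_attained[OF J] .
  have card: "card C + card (- C) = CARD('n) + CARD('m)"
    using card_Compl_add[of C] by simp
  have "maximal_independent_vertices ?J (- C)"
    using C(1) minimal_vertex_cover_iff_maximal_independent[OF J] by blast
  from card_maximal_independent_join_edgeless[OF G this]
  show "tau_max ?J \<le> CARD('n)"
  proof
    assume "CARD('n) \<le> card (- C) + tau_max G"
    then show ?thesis using card C(2) le by linarith
  next
    assume "- C = range Inr"
    then have "card (- C) = CARD('m)" by (simp only: card_image inj_Inr)
    then show ?thesis using card C(2) by linarith
  qed
qed

lemma not_unmixed_join_edgeless:
  fixes G :: "'n::finite graph"
  assumes G: "simple_graph G" and less: "CARD('m::finite) + tau_max G < CARD('n)"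
  shows "\<not> unmixed_graph (graph_join G (edgeless_graph :: 'm graph))"
proof
  let ?J = "graph_join G (edgeless_graph :: 'm graph)"
  assume un: "unmixed_graph ?J"
  have J: "simple_graph ?J" using G by (simp add: simple_graph_join)
  obtain D where D: "minimal_vertex_cover G D" "card D = tau_max G"
    using tau_max_attained[OF G] .
  let ?S = "Inl ` (- D) :: ('n + 'm) set"
  have "minimal_vertex_cover ?J (- ?S)"
    using D(1) minimal_vertex_cover_iff_maximal_independent[OF G]
      minimal_vertex_cover_iff_maximal_independent[OF J, of "- ?S"]
      maximal_independent_join_edgeless_iff[OF G] by auto
  then have "card (- ?S) = card (range Inl :: ('n + 'm) set)"
    using un minimal_vertex_cover_join_left[OF G] unfolding unmixed_graph_def by blast
  moreover have "card (- ?S) + card (- D) = CARD('n) + CARD('m)"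
    using card_Compl_add[of ?S] by (simp add: card_image)
  ultimately show False
    using card_Compl_add[of D] D(2) less by (simp add: card_image)
qed

lemma extreme_point_sum_join_edgeless:
  fixes G :: "'n::finite graph" and p :: "real ^ ('n + 'm::finite)"
  assumes G: "simple_graph G"
    and p: "p extreme_point_of cover_ideal_SP (graph_join G (edgeless_graph :: 'm graph))"
    and le: "CARD('m) + tau_max G \<le> CARD('n)"
    and m: "2 * CARD('m) + tau_max G \<le> CARD('n) + 3"
  shows "(\<Sum>v\<in>UNIV. p $ v) \<le> CARD('n)"
proof -
  let ?J = "graph_join G (edgeless_graph :: 'm graph)"
  define Z where "Z = {v. p $ v = 0}"
  define H where "H = {v. p $ v = 1/2}"
  have J: "simple_graph ?J" using G by (simp add: simple_graph_join)
  have mem: "p \<in> cover_ideal_SP ?J" using p unfolding extreme_point_of_def by blast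
  obtain S where S: "Z \<subseteq> S" "maximal_independent_vertices ?J S"
    using maximal_independent_extends[OF independent_zeros[OF mem]] unfolding Z_def .
  have n: "CARD('n + 'm) = CARD('n) + CARD('m)" by simp
  have bound: "if H = {} then (\<Sum>v\<in>UNIV. p $ v) + card S = CARD('n) + CARD('m)
      else 2 * (\<Sum>v\<in>UNIV. p $ v) + card Z + card S + 2 \<le> 2 * (CARD('n) + CARD('m))"
    using extreme_point_sum_bound[OF J p S(2) S(1)[unfolded Z_def], unfolded n]
    unfolding Z_def H_def .
  have cS: "CARD('n) \<le> card S + tau_max G \<or> S = range Inr"
    by (rule card_maximal_independent_join_edgeless[OF G S(2)])
  then have cS': "CARD('m) \<le> card S"
  proof
    assume "S = range Inr"
    then show ?thesis by (simp add: card_image)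
  qed (use le in linarith)
  show ?thesis
  proof (cases "H = {}")
    case True
    then show ?thesis using bound cS' by auto
  next
    case False
    show ?thesis
    proof (cases "Z = {}")
      case True
      have "p $ v = 1/2" for v
        using extreme_point_half_integral[OF J p, of v] True
          extreme_point_one_has_zero_neighbour[OF J p, of v] unfolding Z_def by auto
      then have "(\<Sum>v\<in>UNIV. p $ v) = (\<Sum>v\<in>(UNIV :: ('n + 'm) set). 1/2)"
        by (intro sum.cong) auto
      also have "\<dots> = (CARD('n) + CARD('m)) / 2" by simp
      finally show ?thesis using le by simp
    next
      case ne: False
      have Zr: "Inr y \<notin> Z" for y
      proof
        assume y: "Inr y \<in> Z"
        then have Sr: "S = range Inr"
          using S(1) iffD1[OF maximal_independent_join_edgeless_iff[OF G] S(2)] by auto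
        have "2 \<le> card (H - S)"
          using extreme_point_halves_outside_independent[OF J p] False S(2)
          unfolding H_def maximal_independent_vertices_def by blast
        then have "H - S \<noteq> {}" by (metis card.empty not_numeral_le_zero)
        then obtain v where "v \<in> H" "v \<notin> S" by blast
        then obtain x where "Inl x \<in> H" unfolding Sr by (cases v) auto
        moreover have "1 \<le> p $ Inl x + p $ Inr y"
          using mem unfolding cover_ideal_SP_def by simp
        ultimately show False using y unfolding H_def Z_def by simp
      qed
      then have "S \<noteq> range Inr"
        using ne S(1) by blast
      then have "CARD('n) \<le> card S + tau_max G"
        using cS by blast
      moreover have "1 \<le> card Z" using ne by (simp add: card_gt_0_iff Suc_leI)
      ultimately show ?thesis using bound False m by simp
    qed
  qed
qed

theorem proposition4p11:
  fixes G :: "'n::finite graph"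
    and G\<^sub>m :: "('n + 'm::finite) graph"
    and r m :: nat
  assumes "simple_graph G"
    and "no_isolated_vertices G"
    and "CARD('n) = r"
    and "r \<ge> 8"
    and "CARD('m) = m"
    and "G\<^sub>m = graph_join G (edgeless_graph :: 'm graph)"
  shows "(tau_max G \<le> r - 4 \<longleftrightarrow> (\<forall>S. maximal_independent_vertices G S \<longrightarrow> 4 \<le> card S)) \<and>
    (tau_max G \<le> r - 4 \<and> 3 \<le> m \<and>
       real m \<le> min ((real r - real (tau_max G) + 3) / 2) (real r / 2) \<longrightarrow>
       (connected_graph G\<^sub>m \<and> \<not> bipartite_graph G\<^sub>m \<and> \<not> unmixed_graph G\<^sub>m \<and> \<not> claw_free_graph G\<^sub>m) \<and>
       (cover_ideal_delta G\<^sub>m = real (tau_max G\<^sub>m) \<and> tau_max G\<^sub>m = r))"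
proof (intro conjI impI)
  show "tau_max G \<le> r - 4 \<longleftrightarrow> (\<forall>S. maximal_independent_vertices G S \<longrightarrow> 4 \<le> card S)"
    using tau_max_le_iff[OF assms(1), of 4] assms(3,4) by simp
next
  assume *: "tau_max G \<le> r - 4 \<and> 3 \<le> m \<and>
       real m \<le> min ((real r - real (tau_max G) + 3) / 2) (real r / 2)"
  then have "2 * real m \<le> real r - real (tau_max G) + 3" by simp
  then have m: "2 * m + tau_max G \<le> r + 3" by linarith
  then have less: "m + tau_max G < r" using * assms(4) by linarith
  have J: "simple_graph G\<^sub>m" using assms(1,6) by (simp add: simple_graph_join)
  show "connected_graph G\<^sub>m" using assms(6) connected_graph_join by simp
  obtain a b where "{b, a} \<in> G"
    using assms(2) unfolding no_isolated_vertices_def by blast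
  then show "\<not> bipartite_graph G\<^sub>m"
    using triangle_not_bipartite[of "Inl b" "Inl a" G\<^sub>m "Inr undefined"] assms(6) by simp
  show "\<not> unmixed_graph G\<^sub>m"
    using not_unmixed_join_edgeless[where 'm = 'm, OF assms(1)] less assms by simp
  show "\<not> claw_free_graph G\<^sub>m"
    using claw_in_join_edgeless[where 'm = 'm, OF assms(1)] * assms by simp
  show tau: "tau_max G\<^sub>m = r"
    using tau_max_join_edgeless[where 'm = 'm, OF assms(1)] less assms by simp
  show "cover_ideal_delta G\<^sub>m = real (tau_max G\<^sub>m)"
  proof (rule cover_ideal_delta_eqI[OF J])
    fix p assume "p extreme_point_of cover_ideal_SP G\<^sub>m"
    then show "(\<Sum>v\<in>UNIV. p $ v) \<le> tau_max G\<^sub>m"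
      using extreme_point_sum_join_edgeless[OF assms(1), of p] m less assms tau by simp
  qed
qed

end
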